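(* Let $H\in\mathbb{R}^{d\times d}$ be symmetric with $\|H\|_{\rm op}\le L_G$. Consider vectors $g,\xi\in\mathbb{R}^d$ and a radius $\Delta>0$ such that $\|\xi\|\le\Delta/4$. Define $\bar v=-H^+g$, with $H^+$ the (Moore–Penrose) pseudoinverse of $H$. Let $q$ denote an eigenvector of $H$ associated to a negative eigenvalue $\lambda<0$. Then the iterates $v^{(t)}$ of tCG-bg$(H,g,\Delta,\xi)$ (see context) satisfy, for all $0\le t\le T_{\rm in}$, $$|\langle v^{(t)}-\bar v,q\rangle|\ge\Big(1+\frac{|\lambda|}{L_G}\Big)^t|\langle v^{(0)}-\bar v,q\rangle|.$$ Moreover, if $\|q\|=1$, the residuals satisfy $\|r^{(t)}\|\ge|\lambda|\,|\langle v^{(t)}-\bar v,q\rangle|$ for all $0\le t\le T_{\rm in}$.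
   Context: Notation: $\|\cdot\|$ is the Euclidean norm, $\|\cdot\|_{\rm op}$ the operator norm. Boundary gradient step BG$(H,g,\Delta,v)$: let $r=-(Hv+g)$. If $\langle r,Hr\rangle\le0$ or $\|v+\bar\alpha r\|\ge\Delta$ with $\bar\alpha=\|r\|^2/\langle r,Hr\rangle$, output $u=v+s'r$ with $s'\ge0$ such that $\|u\|=\Delta$ (if $r=0$, output $u=v$); otherwise output $u=v+\bar\alpha r$. Algorithm tCG-bg$(H,g,\Delta,\xi)$ (parameters $\omega_1\in(0,1)$, $\omega_2>0$; $H$ symmetric $d\times d$, $g,\xi\in\mathbb{R}^d$, $\Delta>0$, $\|\xi\|\le\Delta/4$): set $v^{(0)}=\xi$, $r^{(0)}=-(Hv^{(0)}+g)$, $p^{(0)}=r^{(0)}$. If $r^{(0)}=0$, output $u=v^{(0)}$, stop $=$ residual, $T=0$. For $t=1,2,\dots$: let $\alpha^{(t)}=\|r^{(t-1)}\|^2/\langle p^{(t-1)},Hp^{(t-1)}\rangle$ and $v_+^{(t-1)}=v^{(t-1)}+\alpha^{(t)}p^{(t-1)}$. If $\langle p^{(t-1)},Hp^{(t-1)}\rangle\le0$ or $\|v_+^{(t-1)}\|\ge\Delta/2$, set $v^{(t)}=v^{(t-1)}+sp^{(t-1)}$ with $s\ge0$ such that $\|v^{(t)}\|=\Delta/2$, and output $u=$ BG$(H,g,\Delta,v^{(t)})$, stop $=$ boundary, $T=t$. Otherwise set $v^{(t)}=v_+^{(t-1)}$ and $r^{(t)}=r^{(t-1)}-\alpha^{(t)}Hp^{(t-1)}$;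 if $\|r^{(t)}\|\le\min(\omega_1\|g\|,\omega_2\|g\|^2)$, output $u=v^{(t)}$, stop $=$ residual, $T=t$; else set $\beta^{(t)}=\|r^{(t)}\|^2/\|r^{(t-1)}\|^2$, $p^{(t)}=r^{(t)}+\beta^{(t)}p^{(t-1)}$ and continue. $T$ is the total number of iterations, and $T_{\rm in}=\max\{0\le t\le T:\ \|v^{(0)}\|,\dots,\|v^{(t)}\|<\Delta/2\}$. *)

theory Defs
  imports "HOL-Analysis.Analysis"
begin

definition op_norm :: "real^'n^'m \<Rightarrow> real" where
  "op_norm A = onorm (\<lambda>x. A *v x)"

definition eigenvector_of :: "real^'n^'n \<Rightarrow> real^'n \<Rightarrow> real \<Rightarrow> bool" where
  "eigenvector_of A q lam \<longleftrightarrow> q \<noteq> 0 \<and> A *v q = lam *\<^sub>R q"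

text \<open>The Moore--Penrose pseudoinverse, as the unique solution of the four Penrose equations.\<close>

definition is_pseudoinverse :: "real^'n^'m \<Rightarrow> real^'m^'n \<Rightarrow> bool" where
  "is_pseudoinverse A X \<longleftrightarrow>
     A ** X ** A = A \<and>
     X ** A ** X = X \<and>
     transpose (A ** X) = A ** X \<and>
     transpose (X ** A) = X ** A"

definition pseudoinverse :: "real^'n^'m \<Rightarrow> real^'m^'n" where
  "pseudoinverse A = (THE X. is_pseudoinverse A X)"

text \<open>The point v + s d with s \<ge> 0 at which the ray from v in direction d meets the sphere
  of radius R. If norm v < R and d is nonzero, there is exactly one such s; these conditions
  hold whenever the algorithm below calls this function.\<close>

definition to_sphere :: "real \<Rightarrow> real^'n \<Rightarrow> real^'n \<Rightarrow> real^'n" where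
  "to_sphere R v d = v + (SOME s. 0 \<le> s \<and> norm (v + s *\<^sub>R d) = R) *\<^sub>R d"

definition boundary_gradient_step ::
  "real^'n^'n \<Rightarrow> real^'n \<Rightarrow> real \<Rightarrow> real^'n \<Rightarrow> real^'n" where
  "boundary_gradient_step H g \<Delta> v =
    (let r = - (H *v v + g);
         \<alpha> = (norm r)\<^sup>2 / (r \<bullet> (H *v r))
     in if r \<bullet> (H *v r) \<le> 0 \<or> norm (v + \<alpha> *\<^sub>R r) \<ge> \<Delta>
        then (if r = 0 then v else to_sphere \<Delta> v r)
        else v + \<alpha> *\<^sub>R r)"

datatype tcg_stop = Residual | Boundary

text \<open>State at the end of iteration t: the vectors v, r, p with superscript t and, once the
  algorithm has stopped, the stopping reason together with the output u. When an iteration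
  stops, the algorithm does not assign those of r, p it no longer needs; the corresponding
  fields then keep their previous values.\<close>

record ('n::finite) tcg_state =
  iterate :: "real^'n"
  residual :: "real^'n"
  direction :: "real^'n"
  outcome :: "(tcg_stop \<times> (real^'n)) option"

definition tcg_init ::
  "real^'n^'n \<Rightarrow> real^'n \<Rightarrow> real^'n \<Rightarrow> 'n::finite tcg_state" where
  "tcg_init H g \<xi> =
    (let r = - (H *v \<xi> + g)
     in \<lparr> iterate = \<xi>, residual = r, direction = r,
          outcome = (if r = 0 then Some (Residual, \<xi>) else None) \<rparr>)"

definition tcg_iteration ::
  "real \<Rightarrow> real \<Rightarrow> real^'n^'n \<Rightarrow> real^'n \<Rightarrow> real \<Rightarrow> 'n::finite tcg_state \<Rightarrow> 'n tcg_state" where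
  "tcg_iteration \<omega>\<^sub>1 \<omega>\<^sub>2 H g \<Delta> S =
    (let v = iterate S; r = residual S; p = direction S;
         \<alpha> = (norm r)\<^sup>2 / (p \<bullet> (H *v p));
         v_plus = v + \<alpha> *\<^sub>R p
     in if p \<bullet> (H *v p) \<le> 0 \<or> norm v_plus \<ge> \<Delta> / 2
        then let v' = to_sphere (\<Delta> / 2) v p
             in S \<lparr> iterate := v',
                    outcome := Some (Boundary, boundary_gradient_step H g \<Delta> v') \<rparr>
        else let r' = r - \<alpha> *\<^sub>R (H *v p)
             in if norm r' \<le> min (\<omega>\<^sub>1 * norm g) (\<omega>\<^sub>2 * (norm g)\<^sup>2)
                then S \<lparr> iterate := v_plus, residual := r',
                         outcome := Some (Residual, v_plus) \<rparr>
                else let \<beta> = (norm r')\<^sup>2 / (norm r)\<^sup>2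
                     in S \<lparr> iterate := v_plus, residual := r',
                            direction := r' + \<beta> *\<^sub>R p \<rparr>)"

text \<open>The states are extended to all indices t by keeping the final state after stopping.\<close>

primrec tcg_bg ::
  "real \<Rightarrow> real \<Rightarrow> real^'n^'n \<Rightarrow> real^'n \<Rightarrow> real \<Rightarrow> real^'n \<Rightarrow> nat \<Rightarrow> 'n::finite tcg_state" where
  "tcg_bg \<omega>\<^sub>1 \<omega>\<^sub>2 H g \<Delta> \<xi> 0 = tcg_init H g \<xi>"
| "tcg_bg \<omega>\<^sub>1 \<omega>\<^sub>2 H g \<Delta> \<xi> (Suc t) =
    (let S = tcg_bg \<omega>\<^sub>1 \<omega>\<^sub>2 H g \<Delta> \<xi> t
     in if outcome S = None then tcg_iteration \<omega>\<^sub>1 \<omega>\<^sub>2 H g \<Delta> S else S)"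

definition tcg_T ::
  "real \<Rightarrow> real \<Rightarrow> real^'n^'n \<Rightarrow> real^'n \<Rightarrow> real \<Rightarrow> real^'n \<Rightarrow> nat" where
  "tcg_T \<omega>\<^sub>1 \<omega>\<^sub>2 H g \<Delta> \<xi> = (LEAST t. outcome (tcg_bg \<omega>\<^sub>1 \<omega>\<^sub>2 H g \<Delta> \<xi> t) \<noteq> None)"

definition tcg_T_in ::
  "real \<Rightarrow> real \<Rightarrow> real^'n^'n \<Rightarrow> real^'n \<Rightarrow> real \<Rightarrow> real^'n \<Rightarrow> nat" where
  "tcg_T_in \<omega>\<^sub>1 \<omega>\<^sub>2 H g \<Delta> \<xi> =
    Max {t. t \<le> tcg_T \<omega>\<^sub>1 \<omega>\<^sub>2 H g \<Delta> \<xi> \<and>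
            (\<forall>i\<le>t. norm (iterate (tcg_bg \<omega>\<^sub>1 \<omega>\<^sub>2 H g \<Delta> \<xi> i)) < \<Delta> / 2)}"

end

theory Submission
  imports Defs
begin

text \<open>Let \<open>\<lambda> < 0\<close> be the eigenvalue of \<open>q\<close>. As \<open>q\<close> lies in the range of \<open>H\<close>,
  \<open>\<langle>H\<^sup>+ g, q\<rangle> = \<langle>g, q\<rangle> / \<lambda>\<close>, so \<open>\<langle>r, q\<rangle> = -\<lambda> \<langle>v - vbar, q\<rangle>\<close> whenever \<open>r = -(H v + g)\<close>; the
  residual bound is then Cauchy--Schwarz. Inside the ball the iteration is plain conjugate
  gradients, and the \<open>q\<close>-components \<open>\<rho>\<close> of \<open>r\<close> and \<open>\<pi>\<close> of \<open>p\<close> evolve by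
  \<open>\<rho>' = \<rho> + \<alpha> |\<lambda>| \<pi>\<close> and \<open>\<pi>' = \<rho>' + \<beta> \<pi>\<close>, so they keep a common sign with \<open>|\<pi>| \<ge> |\<rho>|\<close>, and
  \<open>|\<rho>|\<close> grows by a factor of at least \<open>1 + \<alpha> |\<lambda>|\<close>. Finally \<open>r\<close> is \<open>p\<close> minus a multiple of the
  previous direction, to which \<open>p\<close> is \<open>H\<close>-conjugate; hence \<open>\<langle>p, H p\<rangle> \<le> \<langle>r, H r\<rangle> \<le> L \<parallel>r\<parallel>\<^sup>2\<close>, that is
  \<open>\<alpha> \<ge> 1 / L\<close>.\<close>

section \<open>The Moore-Penrose inverse of a symmetric matrix\<close>

lemma symmetric_matrix_inner:
  fixes A :: "real^'n^'n"
  assumes "transpose A = A"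
  shows "x \<bullet> (A *v y) = (A *v x) \<bullet> y"
  by (metis assms dot_lmul_matrix transpose_matrix_vector)

text \<open>\<open>A ** X\<close> and \<open>A ** Y\<close> are both the orthogonal projection onto
  the range of \<open>A\<close>, and the products in the other order coincide similarly; so
  \<open>X ** A ** X\<close> turns into \<open>Y ** A ** Y\<close>.\<close>

lemma is_pseudoinverse_unique:
  assumes "is_pseudoinverse A X" and "is_pseudoinverse A Y"
  shows "X = Y"
proof -
  have X: "A ** X ** A = A" "X ** A ** X = X" "transpose (A ** X) = A ** X"
      "transpose (X ** A) = X ** A"
    and Y: "A ** Y ** A = A" "Y ** A ** Y = Y" "transpose (A ** Y) = A ** Y"
      "transpose (Y ** A) = Y ** A"
    using assms by (auto simp: is_pseudoinverse_def)
  have 1: "A ** X = A ** Y"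
  proof -
    have "A ** X = transpose ((A ** Y) ** (A ** X))"
      using X Y by (simp add: matrix_mul_assoc)
    also have "\<dots> = (A ** X) ** (A ** Y)"
      by (metis X(3) Y(3) matrix_transpose_mul)
    finally show ?thesis
      using X by (simp add: matrix_mul_assoc)
  qed
  have 2: "X ** A = Y ** A"
  proof -
    have "X ** A = transpose ((X ** A) ** (Y ** A))"
      using X Y by (metis matrix_mul_assoc)
    also have "\<dots> = (Y ** A) ** (X ** A)"
      by (metis X(4) Y(4) matrix_transpose_mul)
    finally show ?thesis
      using X by (metis matrix_mul_assoc)
  qed
  show ?thesis
    by (metis 1 2 X(2) Y(2) matrix_mul_assoc)
qed

text \<open>A symmetric matrix is injective on its range, so \<open>G ** A ** A = A\<close> for some \<open>G\<close>;
  then \<open>G ** A\<close> is the orthogonal projection onto the range.\<close>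

lemma symmetric_pseudoinverse_exists:
  fixes A :: "real^'n^'n"
  assumes sym: "transpose A = A"
  shows "\<exists>X. is_pseudoinverse A X"
proof -
  have "\<exists>g. range g \<subseteq> range ((*v) A) \<and> linear g \<and> (\<forall>v\<in>range ((*v) A). g (A *v v) = v)"
  proof (rule linear_exists_left_inverse_on)
    show "linear ((*v) A)" by simp
    then show "subspace (range ((*v) A))"
      by (simp add: linear_subspace_image)
    have "A *v x = A *v y" if "A *v (A *v x) = A *v (A *v y)" for x y
    proof -
      \<comment> \<open>Range and kernel of the symmetric \<open>A\<close> are orthogonal, and
        \<open>z\<close> lies in both.\<close>
      define z where "z = A *v (x - y)"
      have "A *v z = 0"
        using that by (simp add: z_def matrix_vector_mult_diff_distrib)
      then have "z \<bullet> z = 0"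
        unfolding z_def by (metis inner_zero_right sym symmetric_matrix_inner inner_commute)
      then show ?thesis
        by (simp add: z_def matrix_vector_mult_diff_distrib)
    qed
    then show "inj_on ((*v) A) (range ((*v) A))"
      by (auto simp: inj_on_def)
  qed
  then obtain g where "linear g" and g: "\<And>x. g (A *v (A *v x)) = A *v x"
    by blast
  define G where "G = matrix g"
  have GAA: "G ** A ** A = A"
    using g \<open>linear g\<close>
    by (simp add: matrix_eq G_def matrix_works matrix_vector_mul_assoc[symmetric])
  have AAG: "A ** A ** transpose G = A"
    by (metis GAA sym matrix_transpose_mul matrix_mul_assoc)
  \<comment> \<open>Both sides equal \<open>G ** A ** A ** transpose G\<close>; hence
    \<open>G ** A\<close> is symmetric.\<close>
  have GA: "G ** A = A ** transpose G"
    by (metis GAA AAG matrix_mul_assoc)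
  have AGA: "A ** G ** A = A"
    by (metis GA AAG matrix_mul_assoc)
  \<comment> \<open>The candidate \<open>G ** G ** A\<close> collapses to the projection
    \<open>G ** A\<close> when multiplied by \<open>A\<close> on either side.\<close>
  have AX: "A ** (G ** G ** A) = G ** A"
    by (metis AGA GA matrix_mul_assoc)
  have XA: "G ** G ** A ** A = G ** A"
    by (metis GAA matrix_mul_assoc)
  have tGA: "transpose (G ** A) = G ** A"
    by (metis GA matrix_transpose_mul sym)
  have "G ** A ** (G ** G ** A) = G ** G ** A"
    by (metis AX matrix_mul_assoc)
  then have "is_pseudoinverse A (G ** G ** A)"
    by (simp add: is_pseudoinverse_def AX XA tGA GAA)
  then show ?thesis ..
qed

lemma is_pseudoinverse_pseudoinverse:
  fixes A :: "real^'n^'n"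
  assumes "transpose A = A"
  shows "is_pseudoinverse A (pseudoinverse A)"
  unfolding pseudoinverse_def
  using symmetric_pseudoinverse_exists[OF assms] is_pseudoinverse_unique by (metis theI)

text \<open>Writing \<open>lam *\<^sub>R q\<close> as \<open>A *v q\<close> and moving
  \<open>A\<close> to the other factor produces \<open>A ** pseudoinverse A\<close>, a symmetric
  matrix that fixes the range of \<open>A\<close> and thus \<open>q\<close>.\<close>

lemma pseudoinverse_inner_eigenvector:
  fixes A :: "real^'n^'n"
  assumes sym: "transpose A = A" and Aq: "A *v q = lam *\<^sub>R q" and "lam \<noteq> 0"
  shows "lam * ((pseudoinverse A *v g) \<bullet> q) = g \<bullet> q"
proof -
  let ?X = "pseudoinverse A"
  have X: "A ** ?X ** A = A" "transpose (A ** ?X) = A ** ?X"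
    using is_pseudoinverse_pseudoinverse[OF sym] by (auto simp: is_pseudoinverse_def)
  have "lam *\<^sub>R (A *v (?X *v q)) = lam *\<^sub>R q"
    using X(1) Aq by (metis matrix_vector_mul_assoc scaleR_matrix_vector_assoc
        matrix_vector_mult_scaleR)
  then have AXq: "(A ** ?X) *v q = q"
    using \<open>lam \<noteq> 0\<close> by (simp add: matrix_vector_mul_assoc)
  have "lam * ((?X *v g) \<bullet> q) = (?X *v g) \<bullet> (A *v q)"
    by (simp add: Aq)
  also have "\<dots> = ((A ** ?X) *v g) \<bullet> q"
    by (metis sym symmetric_matrix_inner matrix_vector_mul_assoc)
  also have "\<dots> = g \<bullet> ((A ** ?X) *v q)"
    by (simp add: X(2) symmetric_matrix_inner)
  finally show ?thesis by (simp add: AXq)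
qed

section \<open>Operator norm bounds, and the exit point on a sphere\<close>

lemma quadratic_form_le_op_norm:
  "x \<bullet> (A *v x) \<le> op_norm A * (norm x)\<^sup>2"
proof -
  have "norm (A *v x) \<le> op_norm A * norm x"
    unfolding op_norm_def by (rule onorm) simp
  then have "norm x * norm (A *v x) \<le> norm x * (op_norm A * norm x)"
    by (simp add: mult_left_mono)
  then show ?thesis
    using norm_cauchy_schwarz[of x "A *v x"] by (simp add: power2_eq_square mult_ac)
qed

lemma eigenvalue_abs_le_op_norm:
  assumes "eigenvector_of A q lam"
  shows "\<bar>lam\<bar> \<le> op_norm A"
proof -
  have "norm (A *v q) \<le> op_norm A * norm q"
    unfolding op_norm_def by (rule onorm) simp
  then show ?thesis
    using assms by (simp add: eigenvector_of_def)
qed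

lemma norm_to_sphere:
  assumes "norm v < R" and "d \<noteq> 0"
  shows "norm (to_sphere R v d) = R"
proof -
  \<comment> \<open>At \<open>s = b\<close> the added vector has length \<open>R + norm v\<close>,
    so the point is no longer inside the sphere and the intermediate value theorem applies on
    \<open>[0, b]\<close>.\<close>
  define b where "b = (R + norm v) / norm d"
  have "0 \<le> R" using assms(1) norm_ge_zero[of v] by linarith
  then have "0 \<le> b" by (simp add: b_def)
  have "R + norm v = norm (b *\<^sub>R d)"
    using \<open>0 \<le> R\<close> \<open>d \<noteq> 0\<close> by (simp add: b_def)
  also have "\<dots> \<le> norm (v + b *\<^sub>R d) + norm v"
    by (metis add_diff_cancel_left' norm_triangle_ineq4)
  finally have "R \<le> norm (v + b *\<^sub>R d)" by simp
  then have "\<exists>s\<ge>0. s \<le> b \<and> norm (v + s *\<^sub>R d) = R"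
    using assms(1) \<open>0 \<le> b\<close> by (intro IVT') (auto intro!: continuous_intros)
  then have "\<exists>s. 0 \<le> s \<and> norm (v + s *\<^sub>R d) = R" by blast
  then show ?thesis
    unfolding to_sphere_def by (rule someI2_ex) simp
qed

section \<open>One conjugate gradient step\<close>

text \<open>Local conjugacy relations of residual and direction; \<open>p'\<close> is the previous direction,
  and \<open>p' = 0\<close> initially. The last conjunct says that the \<open>q\<close>-components have a common sign and
  that of \<open>p\<close> dominates (unless that of \<open>r\<close> vanishes).\<close>

definition cg_invariant :: "real^'n^'n \<Rightarrow> real^'n \<Rightarrow> real^'n \<Rightarrow> real^'n \<Rightarrow> bool" where
  "cg_invariant H q r p \<longleftrightarrow>
     r \<noteq> 0 \<and> r \<bullet> p = r \<bullet> r \<and>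
     (\<exists>p' \<beta>. r = p - \<beta> *\<^sub>R p' \<and> r \<bullet> p' = 0 \<and> p \<bullet> (H *v p') = 0 \<and> 0 \<le> p' \<bullet> (H *v p')) \<and>
     (r \<bullet> q)\<^sup>2 \<le> (r \<bullet> q) * (p \<bullet> q)"

lemma cg_invariant_init:
  "r \<noteq> 0 \<Longrightarrow> cg_invariant H q r r"
  unfolding cg_invariant_def by (auto simp: power2_eq_square intro!: exI[of _ 0])

lemma cg_invariant_direction_nonzero:
  "cg_invariant H q r p \<Longrightarrow> p \<noteq> 0"
  by (auto simp: cg_invariant_def)

lemma cg_invariant_curvature:
  assumes sym: "transpose H = H" and inv: "cg_invariant H q r p"
  shows "p \<bullet> (H *v p) \<le> r \<bullet> (H *v r)"
proof -
  obtain p' \<beta> where p': "r = p - \<beta> *\<^sub>R p'" "p \<bullet> (H *v p') = 0" "0 \<le> p' \<bullet> (H *v p')"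
    using inv by (auto simp: cg_invariant_def)
  have "p' \<bullet> (H *v p) = 0"
    using p'(2) by (metis sym symmetric_matrix_inner inner_commute)
  then have "r \<bullet> (H *v r) = p \<bullet> (H *v p) + \<beta>\<^sup>2 * (p' \<bullet> (H *v p'))"
    using p'(2) by (simp add: p'(1) matrix_vector_mult_diff_distrib matrix_vector_mult_scaleR
        inner_diff_left inner_diff_right power2_eq_square)
  then show ?thesis using p'(3) by simp
qed

lemma cg_step_length_ge:
  assumes "transpose H = H" and "cg_invariant H q r p"
    and "op_norm H \<le> L" and "0 < L" and pos: "0 < p \<bullet> (H *v p)"
  shows "1 / L \<le> (norm r)\<^sup>2 / (p \<bullet> (H *v p))"
proof -
  have "p \<bullet> (H *v p) \<le> r \<bullet> (H *v r)"
    using assms by (intro cg_invariant_curvature)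
  also have "\<dots> \<le> op_norm H * (norm r)\<^sup>2"
    by (rule quadratic_form_le_op_norm)
  also have "\<dots> \<le> L * (norm r)\<^sup>2"
    using assms by (intro mult_right_mono) auto
  finally show ?thesis
    using pos \<open>0 < L\<close> by (simp add: field_simps)
qed

lemma cg_residual_step_inner:
  fixes H :: "real^'n^'n"
  assumes sym: "transpose H = H" and Hq: "H *v q = lam *\<^sub>R q"
  shows "(r - \<alpha> *\<^sub>R (H *v p)) \<bullet> q = r \<bullet> q - \<alpha> * lam * (p \<bullet> q)"
proof -
  have "(H *v p) \<bullet> q = lam * (p \<bullet> q)"
    using symmetric_matrix_inner[OF sym, of p q] Hq by simp
  then show ?thesis by (simp add: inner_diff_left)
qed

lemma cg_residual_growth:
  assumes sym: "transpose H = H" and Hq: "H *v q = lam *\<^sub>R q" and "lam \<le> 0"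
    and inv: "cg_invariant H q r p" and "0 \<le> \<alpha>"
  shows "(1 + \<alpha> * \<bar>lam\<bar>) * \<bar>r \<bullet> q\<bar> \<le> \<bar>(r - \<alpha> *\<^sub>R (H *v p)) \<bullet> q\<bar>"
proof (cases "r \<bullet> q = 0")
  case False
  let ?\<rho> = "r \<bullet> q" and ?\<pi> = "p \<bullet> q" and ?\<rho>' = "(r - \<alpha> *\<^sub>R (H *v p)) \<bullet> q" and ?a = "\<alpha> * \<bar>lam\<bar>"
  have "?\<rho>\<^sup>2 \<le> ?\<rho> * ?\<pi>" and "0 \<le> ?a"
    using inv \<open>0 \<le> \<alpha>\<close> by (auto simp: cg_invariant_def)
  then have "?a * ?\<rho>\<^sup>2 \<le> ?a * (?\<rho> * ?\<pi>)"
    by (rule mult_left_mono)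
  \<comment> \<open>Multiplying by \<open>?\<rho>\<close> avoids a case split on its sign;
    \<open>\<bar>?\<rho>\<bar>\<close> is cancelled at the end.\<close>
  then have "(1 + ?a) * ?\<rho>\<^sup>2 \<le> ?\<rho>' * ?\<rho>"
    using \<open>lam \<le> 0\<close> cg_residual_step_inner[OF sym Hq, of r \<alpha> p]
    by (simp only: left_diff_distrib) (simp add: algebra_simps power2_eq_square)
  also have "\<dots> \<le> \<bar>?\<rho>'\<bar> * \<bar>?\<rho>\<bar>"
    by (metis abs_ge_self abs_mult)
  finally have "((1 + ?a) * \<bar>?\<rho>\<bar>) * \<bar>?\<rho>\<bar> \<le> \<bar>?\<rho>'\<bar> * \<bar>?\<rho>\<bar>"
    by (simp add: power2_eq_square mult.assoc)
  then show ?thesis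
    using False by (simp add: mult_le_cancel_right)
qed simp

lemma cg_invariant_step:
  assumes sym: "transpose H = H" and Hq: "H *v q = lam *\<^sub>R q" and "lam \<le> 0"
    and inv: "cg_invariant H q r p" and pos: "0 < p \<bullet> (H *v p)"
    and \<alpha>: "\<alpha> = (norm r)\<^sup>2 / (p \<bullet> (H *v p))"
    and r': "r' = r - \<alpha> *\<^sub>R (H *v p)" and "r' \<noteq> 0"
    and \<beta>: "\<beta> = (norm r')\<^sup>2 / (norm r)\<^sup>2"
  shows "cg_invariant H q r' (r' + \<beta> *\<^sub>R p)"
proof -
  obtain p0 \<gamma> where p0: "r = p - \<gamma> *\<^sub>R p0" "r \<bullet> p0 = 0" "p \<bullet> (H *v p0) = 0"
    using inv by (auto simp: cg_invariant_def)
  have "r \<noteq> 0" and rp: "r \<bullet> p = r \<bullet> r" and q: "(r \<bullet> q)\<^sup>2 \<le> (r \<bullet> q) * (p \<bullet> q)"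
    using inv by (auto simp: cg_invariant_def)
  have "0 < \<alpha>" using \<open>r \<noteq> 0\<close> pos by (simp add: \<alpha>)
  have "0 \<le> \<beta>" by (simp add: \<beta>)
  have \<alpha>p: "\<alpha> * (p \<bullet> (H *v p)) = r \<bullet> r"
    using pos by (simp add: \<alpha> power2_norm_eq_inner)
  have \<beta>r: "\<beta> * (r \<bullet> r) = r' \<bullet> r'"
    using \<open>r \<noteq> 0\<close> by (simp add: \<beta> power2_norm_eq_inner)
  have r'p: "r' \<bullet> p = 0"
    using \<alpha>p rp by (simp add: r' inner_diff_left inner_commute[of "H *v p"])
  \<comment> \<open>No global orthogonality of residuals is required: \<open>r\<close> is a
    combination of \<open>p\<close> and \<open>p0\<close>, and \<open>r'\<close> is orthogonal to
    both.\<close>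
  have r'p0: "r' \<bullet> p0 = 0"
    using p0 by (simp add: r' inner_diff_left symmetric_matrix_inner[OF sym])
  have r'r: "r' \<bullet> r = 0"
    using r'p r'p0 by (simp add: p0(1) inner_diff_right)
  \<comment> \<open>Scaling by \<alpha> replaces \<open>H *v p\<close> by a difference of residuals,
    whose inner products with \<open>r'\<close> are known.\<close>
  have "\<alpha> *\<^sub>R (H *v p) = r - r'" by (simp add: r')
  then have "\<alpha> * (r' \<bullet> (H *v p)) = r' \<bullet> (r - r')"
    by (metis inner_scaleR_right)
  then have "\<alpha> * ((r' + \<beta> *\<^sub>R p) \<bullet> (H *v p)) = \<beta> * (\<alpha> * (p \<bullet> (H *v p))) - r' \<bullet> r'"
    using r'r by (simp add: inner_add_left inner_diff_right algebra_simps)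
  then have conj: "(r' + \<beta> *\<^sub>R p) \<bullet> (H *v p) = 0"
    using \<alpha>p \<beta>r \<open>0 < \<alpha>\<close> by simp
  \<comment> \<open>The step adds \<open>\<alpha> * (- lam) * (p \<bullet> q)\<^sup>2\<close> to
    this product, so the new residual keeps the sign of the old direction along
    \<open>q\<close>.\<close>
  have "0 \<le> (r \<bullet> q) * (p \<bullet> q)"
    using q zero_le_power2 order_trans by blast
  moreover have "0 \<le> \<alpha> * (- lam) * (p \<bullet> q)\<^sup>2"
    using \<open>0 < \<alpha>\<close> \<open>lam \<le> 0\<close> by (intro mult_nonneg_nonneg) auto
  ultimately have "0 \<le> (r' \<bullet> q) * (p \<bullet> q)"
    unfolding r' cg_residual_step_inner[OF sym Hq]
    by (simp add: algebra_simps power2_eq_square)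
  then have "0 \<le> \<beta> * ((r' \<bullet> q) * (p \<bullet> q))"
    using \<open>0 \<le> \<beta>\<close> by simp
  then have "(r' \<bullet> q)\<^sup>2 \<le> (r' \<bullet> q) * ((r' + \<beta> *\<^sub>R p) \<bullet> q)"
    by (simp add: inner_add_left algebra_simps power2_eq_square)
  moreover have "r' = (r' + \<beta> *\<^sub>R p) - \<beta> *\<^sub>R p" by simp
  ultimately show ?thesis
    unfolding cg_invariant_def
    using \<open>r' \<noteq> 0\<close> r'p conj pos by (auto simp: inner_add_right less_imp_le)
qed

section \<open>The algorithm inside the ball of radius \<Delta> / 2\<close>

text \<open>The boundary branch lands exactly on the sphere, so a strictly interior result excludes
  it.\<close>

lemma tcg_iteration_inside_ball:
  assumes "norm (iterate S) < \<Delta> / 2" and "direction S \<noteq> 0"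
    and inside: "norm (iterate (tcg_iteration \<omega>\<^sub>1 \<omega>\<^sub>2 H g \<Delta> S)) < \<Delta> / 2"
  defines "\<alpha> \<equiv> (norm (residual S))\<^sup>2 / (direction S \<bullet> (H *v direction S))"
  defines "r' \<equiv> residual S - \<alpha> *\<^sub>R (H *v direction S)"
  shows "0 < direction S \<bullet> (H *v direction S)"
    and "iterate (tcg_iteration \<omega>\<^sub>1 \<omega>\<^sub>2 H g \<Delta> S) = iterate S + \<alpha> *\<^sub>R direction S"
    and "residual (tcg_iteration \<omega>\<^sub>1 \<omega>\<^sub>2 H g \<Delta> S) = r'"
    and "outcome (tcg_iteration \<omega>\<^sub>1 \<omega>\<^sub>2 H g \<Delta> S) = None \<Longrightarrow>
      min (\<omega>\<^sub>1 * norm g) (\<omega>\<^sub>2 * (norm g)\<^sup>2) < norm r' \<and>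
      direction (tcg_iteration \<omega>\<^sub>1 \<omega>\<^sub>2 H g \<Delta> S) =
        r' + ((norm r')\<^sup>2 / (norm (residual S))\<^sup>2) *\<^sub>R direction S"
proof -
  have "\<not> (direction S \<bullet> (H *v direction S) \<le> 0 \<or>
      \<Delta> / 2 \<le> norm (iterate S + \<alpha> *\<^sub>R direction S))" (is "\<not> ?B")
  proof
    assume ?B
    then have "iterate (tcg_iteration \<omega>\<^sub>1 \<omega>\<^sub>2 H g \<Delta> S) =
        to_sphere (\<Delta> / 2) (iterate S) (direction S)"
      by (simp add: tcg_iteration_def Let_def \<alpha>_def)
    then show False
      using inside norm_to_sphere[OF assms(1,2)] by simp
  qed
  then show "0 < direction S \<bullet> (H *v direction S)"
    and "iterate (tcg_iteration \<omega>\<^sub>1 \<omega>\<^sub>2 H g \<Delta> S) = iterate S + \<alpha> *\<^sub>R direction S"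
    and "residual (tcg_iteration \<omega>\<^sub>1 \<omega>\<^sub>2 H g \<Delta> S) = r'"
    and "outcome (tcg_iteration \<omega>\<^sub>1 \<omega>\<^sub>2 H g \<Delta> S) = None \<Longrightarrow>
      min (\<omega>\<^sub>1 * norm g) (\<omega>\<^sub>2 * (norm g)\<^sup>2) < norm r' \<and>
      direction (tcg_iteration \<omega>\<^sub>1 \<omega>\<^sub>2 H g \<Delta> S) =
        r' + ((norm r')\<^sup>2 / (norm (residual S))\<^sup>2) *\<^sub>R direction S"
    by (auto simp: tcg_iteration_def Let_def \<alpha>_def r'_def split: if_splits)
qed

text \<open>\<^const>\<open>cg_invariant\<close> is claimed only while the algorithm runs: an iteration that stops
  does not update the direction.\<close>

lemma tcg_bg_residual_growth:
  fixes H :: "real^'n^'n" and g q \<xi> :: "real^'n" and \<omega>\<^sub>1 \<omega>\<^sub>2 \<Delta> L lam :: real and t :: nat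
  assumes sym: "transpose H = H" and Hq: "H *v q = lam *\<^sub>R q" and "lam \<le> 0"
    and L: "op_norm H \<le> L" "0 < L" and \<omega>: "0 \<le> \<omega>\<^sub>1" "0 \<le> \<omega>\<^sub>2"
  defines "S \<equiv> tcg_bg \<omega>\<^sub>1 \<omega>\<^sub>2 H g \<Delta> \<xi>"
  assumes "\<forall>i<t. outcome (S i) = None" and "\<forall>i\<le>t. norm (iterate (S i)) < \<Delta> / 2"
  shows "residual (S t) = - (H *v iterate (S t) + g) \<and>
    (1 + \<bar>lam\<bar> / L) ^ t * \<bar>residual (S 0) \<bullet> q\<bar> \<le> \<bar>residual (S t) \<bullet> q\<bar> \<and>
    (outcome (S t) = None \<longrightarrow> cg_invariant H q (residual (S t)) (direction (S t)))"
  using assms(9,10)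
proof (induction t)
  case 0
  then show ?case
    by (auto simp: S_def tcg_init_def Let_def intro!: cg_invariant_init)
next
  case (Suc t)
  define v r p where "v = iterate (S t)" and "r = residual (S t)" and "p = direction (S t)"
  define \<alpha> where "\<alpha> = (norm r)\<^sup>2 / (p \<bullet> (H *v p))"
  define r' where "r' = r - \<alpha> *\<^sub>R (H *v p)"
  have none: "outcome (S t) = None" using Suc.prems by simp
  then have S_Suc: "S (Suc t) = tcg_iteration \<omega>\<^sub>1 \<omega>\<^sub>2 H g \<Delta> (S t)"
    by (simp add: S_def Let_def)
  have r: "r = - (H *v v + g)" and inv: "cg_invariant H q r p"
    and IH: "(1 + \<bar>lam\<bar> / L) ^ t * \<bar>residual (S 0) \<bullet> q\<bar> \<le> \<bar>r \<bullet> q\<bar>"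
    using Suc none by (auto simp: v_def r_def p_def)
  have "norm (iterate (S t)) < \<Delta> / 2" "direction (S t) \<noteq> 0"
    "norm (iterate (tcg_iteration \<omega>\<^sub>1 \<omega>\<^sub>2 H g \<Delta> (S t))) < \<Delta> / 2"
    using Suc.prems cg_invariant_direction_nonzero[OF inv] S_Suc by (auto simp: p_def)
  note step = tcg_iteration_inside_ball[OF this, folded S_Suc v_def r_def p_def,
      folded \<alpha>_def, folded r'_def]
  have \<alpha>: "1 / L \<le> \<alpha>"
    unfolding \<alpha>_def using sym inv L step(1) by (rule cg_step_length_ge)
  then have "0 \<le> \<alpha>" using \<open>0 < L\<close> by (meson order_trans zero_le_divide_1_iff less_imp_le)
  have "residual (S (Suc t)) = - (H *v iterate (S (Suc t)) + g)"
    by (simp add: step(2,3) r'_def r matrix_vector_right_distrib matrix_vector_mult_scaleR)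
  moreover have "(1 + \<bar>lam\<bar> / L) ^ Suc t * \<bar>residual (S 0) \<bullet> q\<bar> \<le> \<bar>residual (S (Suc t)) \<bullet> q\<bar>"
  proof -
    have "(1 + \<bar>lam\<bar> / L) ^ Suc t * \<bar>residual (S 0) \<bullet> q\<bar> \<le> (1 + \<bar>lam\<bar> / L) * \<bar>r \<bullet> q\<bar>"
      using mult_left_mono[OF IH, of "1 + \<bar>lam\<bar> / L"] \<open>0 < L\<close> by (simp add: mult.assoc)
    also have "\<dots> \<le> (1 + \<alpha> * \<bar>lam\<bar>) * \<bar>r \<bullet> q\<bar>"
      using mult_right_mono[OF \<alpha>, of "\<bar>lam\<bar>"] by (intro mult_right_mono) auto
    also have "\<dots> \<le> \<bar>r' \<bullet> q\<bar>"
      unfolding r'_def using sym Hq \<open>lam \<le> 0\<close> inv \<open>0 \<le> \<alpha>\<close> by (rule cg_residual_growth)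
    finally show ?thesis by (simp add: step(3))
  qed
  moreover have "cg_invariant H q (residual (S (Suc t))) (direction (S (Suc t)))"
    if "outcome (S (Suc t)) = None"
  proof -
    \<comment> \<open>The stopping threshold is nonnegative, so continuing forces a nonzero
      residual.\<close>
    have "0 \<le> min (\<omega>\<^sub>1 * norm g) (\<omega>\<^sub>2 * (norm g)\<^sup>2)"
      using \<omega> by simp
    also have "\<dots> < norm r'"
      using step(4) that by simp
    finally have "r' \<noteq> 0" by simp
    then have "cg_invariant H q r' (r' + ((norm r')\<^sup>2 / (norm r)\<^sup>2) *\<^sub>R p)"
      using cg_invariant_step[OF sym Hq \<open>lam \<le> 0\<close> inv step(1) \<alpha>_def r'_def] by simp
    then show ?thesis
      using step(3,4) that by simp
  qed
  ultimately show ?case by blast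
qed

text \<open>Holds without a termination proof: if the algorithm never stopped, \<^const>\<open>tcg_T\<close> would be
  an unspecified number, but all outcomes would be \<^const>\<open>None\<close>.\<close>

lemma tcg_T_in_inside:
  assumes "norm \<xi> < \<Delta> / 2" and "t \<le> tcg_T_in \<omega>\<^sub>1 \<omega>\<^sub>2 H g \<Delta> \<xi>"
  shows "\<forall>i<t. outcome (tcg_bg \<omega>\<^sub>1 \<omega>\<^sub>2 H g \<Delta> \<xi> i) = None"
    and "\<forall>i\<le>t. norm (iterate (tcg_bg \<omega>\<^sub>1 \<omega>\<^sub>2 H g \<Delta> \<xi> i)) < \<Delta> / 2"
proof -
  let ?A = "{t. t \<le> tcg_T \<omega>\<^sub>1 \<omega>\<^sub>2 H g \<Delta> \<xi> \<and>
            (\<forall>i\<le>t. norm (iterate (tcg_bg \<omega>\<^sub>1 \<omega>\<^sub>2 H g \<Delta> \<xi> i)) < \<Delta> / 2)}"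
  have "finite ?A" by simp
  moreover have "0 \<in> ?A"
    using assms(1) by (simp add: tcg_init_def Let_def)
  ultimately have "tcg_T_in \<omega>\<^sub>1 \<omega>\<^sub>2 H g \<Delta> \<xi> \<in> ?A"
    unfolding tcg_T_in_def using Max_in by blast
  then have "t \<le> tcg_T \<omega>\<^sub>1 \<omega>\<^sub>2 H g \<Delta> \<xi>"
    and "\<forall>i\<le>t. norm (iterate (tcg_bg \<omega>\<^sub>1 \<omega>\<^sub>2 H g \<Delta> \<xi> i)) < \<Delta> / 2"
    using assms(2) by auto
  then show "\<forall>i<t. outcome (tcg_bg \<omega>\<^sub>1 \<omega>\<^sub>2 H g \<Delta> \<xi> i) = None"
    and "\<forall>i\<le>t. norm (iterate (tcg_bg \<omega>\<^sub>1 \<omega>\<^sub>2 H g \<Delta> \<xi> i)) < \<Delta> / 2"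
    unfolding tcg_T_def by (meson not_less_Least order.strict_trans2)+
qed

theorem proposition4p4:
  fixes H :: "real^'n^'n" and g \<xi> vbar q :: "real^'n"
    and \<omega>\<^sub>1 \<omega>\<^sub>2 \<Delta> L\<^sub>G lam :: real
    and v r :: "nat \<Rightarrow> real^'n" and T_in :: nat
  assumes "0 < \<omega>\<^sub>1" and "\<omega>\<^sub>1 < 1" and "0 < \<omega>\<^sub>2"
    and "transpose H = H"
    and "op_norm H \<le> L\<^sub>G"
    and "0 < \<Delta>"
    and "norm \<xi> \<le> \<Delta> / 4"
    and "vbar = - (pseudoinverse H *v g)"
    and "eigenvector_of H q lam"
    and "lam < 0"
    and "\<And>t. v t = iterate (tcg_bg \<omega>\<^sub>1 \<omega>\<^sub>2 H g \<Delta> \<xi> t)"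
    and "\<And>t. r t = residual (tcg_bg \<omega>\<^sub>1 \<omega>\<^sub>2 H g \<Delta> \<xi> t)"
    and "T_in = tcg_T_in \<omega>\<^sub>1 \<omega>\<^sub>2 H g \<Delta> \<xi>"
  shows "(\<forall>t\<le>T_in. \<bar>(v t - vbar) \<bullet> q\<bar> \<ge> (1 + \<bar>lam\<bar> / L\<^sub>G) ^ t * \<bar>(v 0 - vbar) \<bullet> q\<bar>) \<and>
    (norm q = 1 \<longrightarrow> (\<forall>t\<le>T_in. norm (r t) \<ge> \<bar>lam\<bar> * \<bar>(v t - vbar) \<bullet> q\<bar>))"
proof -
  have Hq: "H *v q = lam *\<^sub>R q"
    using assms(9) by (simp add: eigenvector_of_def)
  \<comment> \<open>A nonzero eigenvalue makes the operator norm positive.\<close>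
  have "0 < L\<^sub>G"
    using eigenvalue_abs_le_op_norm[OF assms(9)] assms(5,10) by linarith
  have growth: "r t = - (H *v v t + g) \<and> (1 + \<bar>lam\<bar> / L\<^sub>G) ^ t * \<bar>r 0 \<bullet> q\<bar> \<le> \<bar>r t \<bullet> q\<bar>"
    if "t \<le> T_in" for t
  proof -
    have "norm \<xi> < \<Delta> / 2" using assms(6,7) by linarith
    note inside = tcg_T_in_inside[OF this that[unfolded assms(13)]]
    show ?thesis
      using tcg_bg_residual_growth[OF assms(4) Hq _ assms(5) \<open>0 < L\<^sub>G\<close> _ _ inside] assms(1,3,10)
      by (metis assms(11,12) less_imp_le)
  qed
  have rq: "\<bar>r t \<bullet> q\<bar> = \<bar>lam\<bar> * \<bar>(v t - vbar) \<bullet> q\<bar>" if "t \<le> T_in" for t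
  proof -
    have "(H *v v t) \<bullet> q = lam * (v t \<bullet> q)"
      using symmetric_matrix_inner[OF assms(4), of "v t" q] Hq by simp
    moreover have "g \<bullet> q = - (lam * (vbar \<bullet> q))"
      using pseudoinverse_inner_eigenvector[OF assms(4) Hq, of g] assms(8,10) by simp
    moreover have "r t = - (H *v v t + g)"
      using growth[OF that] ..
    ultimately have "r t \<bullet> q = - (lam * ((v t - vbar) \<bullet> q))"
      by (simp add: inner_diff_left inner_add_left right_diff_distrib)
    then show ?thesis by (simp add: abs_mult)
  qed
  have "(1 + \<bar>lam\<bar> / L\<^sub>G) ^ t * \<bar>(v 0 - vbar) \<bullet> q\<bar> \<le> \<bar>(v t - vbar) \<bullet> q\<bar>" if "t \<le> T_in" for t
  proof -
    \<comment> \<open>By \<open>rq\<close>, this is the growth of the residual component; the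
      positive factor \<open>\<bar>lam\<bar>\<close> then cancels.\<close>
    have "\<bar>lam\<bar> * ((1 + \<bar>lam\<bar> / L\<^sub>G) ^ t * \<bar>(v 0 - vbar) \<bullet> q\<bar>) \<le> \<bar>lam\<bar> * \<bar>(v t - vbar) \<bullet> q\<bar>"
      using growth[OF that] rq[OF that] rq[of 0] by (simp add: mult_ac)
    then show ?thesis
      using assms(10) by (simp add: mult_le_cancel_left)
  qed
  moreover have "\<bar>lam\<bar> * \<bar>(v t - vbar) \<bullet> q\<bar> \<le> norm (r t)" if "norm q = 1" "t \<le> T_in" for t
    using Cauchy_Schwarz_ineq2[of "r t" q] that rq by simp
  ultimately show ?thesis by blast
qed

end
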